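(* Let $n>1$ be an integer with prime factorization $n=p_1^{m_1}\cdots p_\omega^{m_\omega}$ ($p_1<\dots<p_\omega$ distinct primes, $m_i\ge 1$), and let $M'(n)=[m_1,\dots,m_\omega]$ be its prime signature (a multiset). For a nonempty finite multiset $M$ of positive integers put $V(M)=\prod_{m\in M}(m+1)$, and define $E(M)$ recursively by: $E(M)=m_1$ if $M=[m_1]$ has one element; and, if $|M|>1$, $E(M)=E(M-[m_i])\cdot(m_i+1)+m_i\cdot V(M-[m_i])$, where $m_i$ is an element of $M$ and $M-[m_i]$ denotes $M$ with one copy of $m_i$ removed. Then, whichever element is removed at each step, $E(M'(n))=|E^H(n)|$, the number of arcs of the Hasse diagram $G^H(n)$.
   Context: For a positive integer $n$, $V(n)$ is the set of positive divisors of $n$. The transitive closure graph $G^T(n)$ is the directed graph on $V(n)$ with arc set $E^T(n)=\{(a,b): a,b\in V(n),\ a<b,\ a\mid b\}$. The Hasse diagram $G^H(n)$ is the directed graph on $V(n)$ with arc set $E^H(n)$ consisting of those $(a,b)\in E^T(n)$ for which there is no $c\in V(n)$ with $a<c<b$, $a\mid c$ and $c\mid b$. *)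

theory Defs
  imports "HOL-Computational_Algebra.Primes" "Graph_Theory.Pair_Digraph"
begin

definition pos_divisors :: "nat \<Rightarrow> nat set" where
  "pos_divisors n = {d. 0 < d \<and> d dvd n}"

definition transitive_closure_graph :: "nat \<Rightarrow> nat pair_pre_digraph" where
  "transitive_closure_graph n =
     \<lparr> pverts = pos_divisors n,
       parcs = {(a, b). a \<in> pos_divisors n \<and> b \<in> pos_divisors n \<and> a < b \<and> a dvd b} \<rparr>"

definition hasse_diagram :: "nat \<Rightarrow> nat pair_pre_digraph" where
  "hasse_diagram n =
     \<lparr> pverts = pos_divisors n,
       parcs = {(a, b). (a, b) \<in> parcs (transitive_closure_graph n) \<and>
                  \<not> (\<exists>c \<in> pos_divisors n. a < c \<and> c < b \<and> a dvd c \<and> c dvd b)} \<rparr>"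

definition prime_signature :: "nat \<Rightarrow> nat multiset" where
  "prime_signature n = image_mset (\<lambda>p. multiplicity p n) (mset_set (prime_factors n))"

definition V_mset :: "nat multiset \<Rightarrow> nat" where
  "V_mset M = (\<Prod>m\<in>#M. m + 1)"

text \<open>
  The recursion for \<open>E\<close> leaves open which element is removed at each step, so it is
  not a function definition as it stands. \<open>E_value M e\<close> says that \<open>e\<close> arises from
  \<open>M\<close> by the recursion for some sequence of choices; neither the existence of \<open>e\<close> nor
  its independence of the choices is built in.
\<close>

inductive E_value :: "nat multiset \<Rightarrow> nat \<Rightarrow> bool" where
  single: "E_value {#m#} m"
| remove: "E_value M (e * (m + 1) + m * V_mset (M - {#m#}))"
    if "size M > 1" and "m \<in># M" and "E_value (M - {#m#}) e"

end

theory Submission imports Defs begin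

text \<open>
  The recursion for \<open>E\<close> has the solution \<open>E(M) = (\<Sum>m\<in>M. m * V(M - [m]))\<close>, an expression in
  which no choice of elements occurs. On the other side, the arcs of the Hasse diagram are the
  pairs \<open>(a, a * p)\<close> with \<open>p\<close> prime and \<open>a * p\<close> dividing \<open>n\<close>; for fixed \<open>p\<close> they correspond to
  the divisors \<open>a\<close> of \<open>n / p\<close>, whose number is \<open>m * V(M - [m])\<close> for the exponent \<open>m\<close> of \<open>p\<close>
  in \<open>n\<close>.
\<close>

definition E_closed :: "nat multiset \<Rightarrow> nat" where
  "E_closed M = (\<Sum>m\<in>#M. m * V_mset (M - {#m#}))"

text \<open>Every summand that removes an entry of \<open>N\<close> keeps \<open>m\<close> and so
  gains the factor \<open>m + 1\<close>; the removal of \<open>m\<close> itself gives the last term.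
  This is the recursion of \<open>E_value\<close> with an arbitrary \<open>m\<close> split off,
  which is why the choices do not matter.\<close>

lemma E_closed_add_mset:
  "E_closed (add_mset m N) = E_closed N * (m + 1) + m * V_mset N"
proof -
  have "k * V_mset (add_mset m N - {#k#}) = k * V_mset (N - {#k#}) * (m + 1)"
    if "k \<in># N" for k
    using that by (simp add: V_mset_def algebra_simps)
  hence "(\<Sum>k\<in>#N. k * V_mset (add_mset m N - {#k#})) = (\<Sum>k\<in>#N. k * V_mset (N - {#k#}) * (m + 1))"
    by (intro arg_cong[of _ _ sum_mset] image_mset_cong)
  also have "\<dots> = E_closed N * (m + 1)"
    by (simp only: E_closed_def sum_mset_distrib_right)
  finally show ?thesis
    by (simp add: E_closed_def)
qed

lemma E_value_imp_E_closed: "E_value M e \<Longrightarrow> e = E_closed M"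
proof (induction rule: E_value.induct)
  case (single m)
  show ?case by (simp add: E_closed_def V_mset_def)
next
  case (remove M m e)
  then show ?case
    using E_closed_add_mset[of m "M - {#m#}"] by simp
qed

text \<open>Since \<open>E_value\<close> is only a relation, uniqueness of its value does not give
  existence. Multiset induction supplies one order of removal: the element added last goes
  first.\<close>

lemma ex_E_value: "M \<noteq> {#} \<Longrightarrow> \<exists>e. E_value M e"
proof (induction M)
  case empty
  then show ?case by simp
next
  case (add m M)
  show ?case
  proof (cases "M = {#}")
    case True
    then show ?thesis by (auto intro: E_value.single)
  next
    case False
    then obtain e where "E_value M e"
      using add.IH by blast
    with False show ?thesis
      using E_value.remove[of "add_mset m M" m e] by (auto simp: nonempty_has_size)
  qed
qed

lemma E_value_iff_E_closed: "M \<noteq> {#} \<Longrightarrow> E_value M e \<longleftrightarrow> e = E_closed M"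
  using E_value_imp_E_closed ex_E_value by blast

text \<open>Each divisor is \<open>p ^ i * d\<close> for exactly one pair of
  \<open>i \<le> k\<close> and \<open>d dvd m\<close>; the exponent \<open>i\<close> is recovered as
  the multiplicity of \<open>p\<close>, because \<open>p\<close> does not divide
  \<open>d\<close>.\<close>

lemma card_divisors_prime_power_mult:
  fixes p m :: nat
  assumes "prime p" "\<not> p dvd m"
  shows "card {d. d dvd p ^ k * m} = (k + 1) * card {d. d dvd m}"
proof -
  have "bij_betw (\<lambda>(i, d). p ^ i * d) ({..k} \<times> {d. d dvd m}) {d. d dvd p ^ k * m}"
    unfolding bij_betw_def
  proof
    show "inj_on (\<lambda>(i, d). p ^ i * d) ({..k} \<times> {d. d dvd m})"
    proof (rule inj_onI, clarify)
      fix i d j c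
      assume dvd: "d dvd m" "c dvd m" and eq: "p ^ i * d = p ^ j * c"
      have p0: "p \<noteq> 0" using assms(1) by auto
      have nd: "\<not> p dvd d" "\<not> p dvd c"
        using assms(2) dvd dvd_trans by blast+
      have "multiplicity p (p ^ i * d) = i"
        by (rule multiplicity_decomposeI[OF refl nd(1) p0])
      moreover have "multiplicity p (p ^ i * d) = j"
        by (rule multiplicity_decomposeI[OF eq nd(2) p0])
      ultimately show "i = j \<and> d = c"
        using eq p0 by simp
    qed
    show "(\<lambda>(i, d). p ^ i * d) ` ({..k} \<times> {d. d dvd m}) = {d. d dvd p ^ k * m}"
    proof (intro equalityI subsetI)
      fix x assume "x \<in> {d. d dvd p ^ k * m}"
      then obtain b c where x: "x = b * c" "b dvd p ^ k" "c dvd m"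
        using division_decomp by blast
      then obtain i where "i \<le> k" "b = p ^ i"
        using divides_primepow_nat[OF assms(1)] by blast
      with x show "x \<in> (\<lambda>(i, d). p ^ i * d) ` ({..k} \<times> {d. d dvd m})"
        by force
    qed (auto intro!: mult_dvd_mono le_imp_power_dvd)
  qed
  hence "card {d. d dvd p ^ k * m} = card ({..k} \<times> {d. d dvd m})"
    by (rule bij_betw_same_card[symmetric])
  thus ?thesis by (simp add: card_cartesian_product)
qed

text \<open>Zero exponents are allowed, so that \<open>n div p\<close> can be treated over the prime
  factors of \<open>n\<close> even when \<open>p\<close> no longer divides it.\<close>

lemma card_divisors_prod_prime_powers:
  fixes A :: "nat set"
  assumes "finite A" "\<And>p. p \<in> A \<Longrightarrow> prime p"
  shows "card {d. d dvd (\<Prod>p\<in>A. p ^ f p)} = (\<Prod>p\<in>A. f p + 1)"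
  using assms
proof (induction A rule: finite_induct)
  case empty
  then show ?case by simp
next
  case (insert p A)
  have "\<not> p dvd (\<Prod>q\<in>A. q ^ f q)"
  proof
    assume "p dvd (\<Prod>q\<in>A. q ^ f q)"
    then obtain q where q: "q \<in> A" "p dvd q ^ f q"
      using insert by (auto simp: prime_dvd_prod_iff)
    hence "p dvd q"
      using insert.prems prime_dvd_power by blast
    hence "p = q"
      using q insert.prems primes_dvd_imp_eq by blast
    with q insert.hyps show False by simp
  qed
  then show ?case
    using insert card_divisors_prime_power_mult[of p "\<Prod>q\<in>A. q ^ f q" "f p"] by simp
qed

text \<open>Division by \<open>p\<close> lowers only the exponent of \<open>p\<close> by one, so the
  factor that \<open>p\<close> contributes to the divisor count drops from
  \<open>multiplicity p n + 1\<close> to \<open>multiplicity p n\<close>.\<close>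

lemma card_divisors_div_prime:
  fixes n p :: nat
  assumes "n > 0" "p \<in> prime_factors n"
  shows "card {d. d dvd n div p} =
    multiplicity p n * (\<Prod>q\<in>prime_factors n - {p}. multiplicity q n + 1)"
proof -
  let ?A = "prime_factors n"
  let ?f = "\<lambda>q. multiplicity q n"
  let ?g = "?f(p := ?f p - 1)"
  have fp: "?f p > 0"
    using assms prime_factors_multiplicity by auto
  have "p > 0"
    using assms in_prime_factors_imp_prime prime_gt_0_nat by blast
  have split: "(\<Prod>q\<in>?A. h q) = h p * (\<Prod>q\<in>?A - {p}. h q)" for h :: "nat \<Rightarrow> nat"
    using assms(2) by (intro prod.remove) auto
  have pow: "p ^ ?f p = p * p ^ (?f p - 1)"
    using fp by (metis power_minus_mult mult.commute)
  have "n = (\<Prod>q\<in>?A. q ^ ?f q)"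
    using assms(1) by (simp add: prime_factorization_nat)
  also have "\<dots> = p * (\<Prod>q\<in>?A. q ^ ?g q)"
    by (simp add: split pow mult.assoc)
  finally have "n div p = (\<Prod>q\<in>?A. q ^ ?g q)"
    using \<open>p > 0\<close> by (metis nonzero_mult_div_cancel_left less_not_refl)
  moreover have "card {d. d dvd (\<Prod>q\<in>?A. q ^ ?g q)} = (\<Prod>q\<in>?A. ?g q + 1)"
    by (rule card_divisors_prod_prime_powers) auto
  ultimately show ?thesis
    using fp by (simp add: split)
qed

lemma E_closed_prime_signature:
  assumes "n > 0"
  shows "E_closed (prime_signature n) = (\<Sum>p\<in>prime_factors n. card {d. d dvd n div p})"
proof -
  let ?f = "\<lambda>q. multiplicity q n"
  have "?f p * V_mset (prime_signature n - {#?f p#}) = card {d. d dvd n div p}"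
    if p: "p \<in> prime_factors n" for p
  proof -
    \<comment> \<open>Splitting off the prime before taking exponents ensures that exactly one copy
      of its exponent is removed, even if other primes share that exponent.\<close>
    have "mset_set (prime_factors n) = add_mset p (mset_set (prime_factors n - {p}))"
      using p by (simp add: mset_set.remove)
    hence "prime_signature n - {#?f p#} = image_mset ?f (mset_set (prime_factors n - {p}))"
      by (simp add: prime_signature_def)
    thus ?thesis
      using card_divisors_div_prime[OF assms p]
      by (simp add: V_mset_def prod_unfold_prod_mset image_mset.compositionality comp_def)
  qed
  hence "(\<Sum>p\<in>prime_factors n. ?f p * V_mset (prime_signature n - {#?f p#})) =
      (\<Sum>p\<in>prime_factors n. card {d. d dvd n div p})"
    by (rule sum.cong[OF refl])
  moreover have "(\<Sum>m\<in>#prime_signature n. h m) = (\<Sum>p\<in>prime_factors n. h (?f p))"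
    for h :: "nat \<Rightarrow> nat"
    by (simp add: prime_signature_def sum_unfold_sum_mset image_mset.compositionality comp_def)
  ultimately show ?thesis
    by (simp only: E_closed_def)
qed

text \<open>If \<open>b = a * k\<close> and \<open>p\<close> is a prime factor of \<open>k\<close>,
  then \<open>a * p\<close> lies above \<open>a\<close> and divides \<open>b\<close>, so on an arc
  it must equal \<open>b\<close>. Conversely, a number strictly between \<open>a\<close> and
  \<open>a * p\<close> would give a nontrivial divisor of \<open>p\<close>.\<close>

lemma parcs_hasse_diagram_iff:
  assumes "n > 0"
  shows "(a, b) \<in> parcs (hasse_diagram n) \<longleftrightarrow> (\<exists>p. prime p \<and> b = a * p \<and> a * p dvd n)"
proof
  assume "(a, b) \<in> parcs (hasse_diagram n)"
  hence ab: "0 < a" "b dvd n" "a < b" "a dvd b"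
    and no: "\<And>c. \<lbrakk>0 < c; c dvd n; a < c; c < b; a dvd c; c dvd b\<rbrakk> \<Longrightarrow> False"
    by (auto simp: hasse_diagram_def transitive_closure_graph_def pos_divisors_def)
  from ab obtain k where k: "b = a * k" by auto
  hence "k \<noteq> 1" using ab by auto
  then obtain p where p: "prime p" "p dvd k"
    using prime_factor_nat by blast
  have c: "a * p dvd b" "a < a * p"
    using p k ab prime_gt_1_nat by auto
  moreover have "a * p dvd n"
    using c ab dvd_trans by blast
  moreover have "a * p \<le> b"
    using c ab by (intro dvd_imp_le) auto
  ultimately have "b = a * p"
    using no[of "a * p"] by fastforce
  with p \<open>a * p dvd n\<close> show "\<exists>p. prime p \<and> b = a * p \<and> a * p dvd n" by blast
next
  assume "\<exists>p. prime p \<and> b = a * p \<and> a * p dvd n"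
  then obtain p where p: "prime p" "b = a * p" "a * p dvd n" by blast
  have a: "a > 0" "a dvd n"
    using p assms by (auto intro: dvd_mult_left gr0I)
  have "\<not> (a < c \<and> c < b \<and> a dvd c \<and> c dvd b)" for c
  proof
    assume c: "a < c \<and> c < b \<and> a dvd c \<and> c dvd b"
    then obtain k where k: "c = a * k" by auto
    hence "k dvd p" using c p a by simp
    hence "k = 1 \<or> k = p" using p(1) prime_nat_iff by blast
    thus False using c k p by auto
  qed
  thus "(a, b) \<in> parcs (hasse_diagram n)"
    using p a prime_gt_1_nat[of p]
    by (auto simp: hasse_diagram_def transitive_closure_graph_def pos_divisors_def)
qed

text \<open>Arcs are grouped by the prime quotient of their endpoints.\<close>

lemma card_parcs_hasse_diagram:
  assumes "n > 0"
  shows "card (parcs (hasse_diagram n)) = (\<Sum>p\<in>prime_factors n. card {d. d dvd n div p})"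
proof -
  let ?S = "SIGMA p:prime_factors n. {d. d dvd n div p}"
  have dvd_iff: "d dvd n div p \<longleftrightarrow> d * p dvd n" if "p \<in> prime_factors n" for d p
  proof -
    have "p dvd n" "p \<noteq> 0"
      using that in_prime_factors_imp_prime[of p n] by auto
    thus ?thesis by (simp add: dvd_div_iff_mult)
  qed
  \<comment> \<open>Positivity lets \<open>p\<close> be cancelled from \<open>a * p\<close>, hence
    recovered from the arc.\<close>
  have pos: "d > 0" if "d dvd n div p" "p \<in> prime_factors n" for d p
    using that assms by (auto simp: dvd_iff intro: gr0I)
  have "bij_betw (\<lambda>(p, a). (a, a * p)) ?S (parcs (hasse_diagram n))"
    unfolding bij_betw_def
  proof
    show "inj_on (\<lambda>(p, a). (a, a * p)) ?S"
      by (auto simp: inj_on_def dest: pos)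
    show "(\<lambda>(p, a). (a, a * p)) ` ?S = parcs (hasse_diagram n)"
    proof (intro equalityI subsetI)
      fix x assume "x \<in> (\<lambda>(p, a). (a, a * p)) ` ?S"
      then obtain p a where "x = (a, a * p)" "p \<in> prime_factors n" "a dvd n div p" by auto
      thus "x \<in> parcs (hasse_diagram n)"
        by (auto simp: parcs_hasse_diagram_iff[OF assms] dvd_iff)
    next
      fix x assume x: "x \<in> parcs (hasse_diagram n)"
      obtain a b where ab: "x = (a, b)" by (cases x)
      with x obtain p where p: "prime p" "b = a * p" "a * p dvd n"
        using parcs_hasse_diagram_iff[OF assms] by blast
      hence "p \<in> prime_factors n"
        using assms by (auto simp: prime_factors_dvd dest: dvd_mult_right)
      with p ab show "x \<in> (\<lambda>(p, a). (a, a * p)) ` ?S"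
        by (force simp: dvd_iff)
    qed
  qed
  hence "card (parcs (hasse_diagram n)) = card ?S"
    by (rule bij_betw_same_card[symmetric])
  also have "\<dots> = (\<Sum>p\<in>prime_factors n. card {d. d dvd n div p})"
  proof (rule card_SigmaI)
    show "\<forall>p\<in>prime_factors n. finite {d. d dvd n div p}"
    proof
      fix p assume "p \<in> prime_factors n"
      \<comment> \<open>This must be excluded from being \<open>0\<close>, since every natural
        number divides \<open>0\<close>; \<open>pos\<close> applies to \<open>n div p\<close> as a
        divisor of itself.\<close>
      hence "n div p > 0"
        using pos[OF dvd_refl] by blast
      thus "finite {d. d dvd n div p}" by simp
    qed
  qed simp
  finally show ?thesis .
qed

theorem theorem2:
  fixes n e :: nat
  assumes "n > 1"
  shows "E_value (prime_signature n) e \<longleftrightarrow> e = card (parcs (hasse_diagram n))"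
proof -
  \<comment> \<open>No rule of \<open>E_value\<close> yields a value for \<open>{#}\<close>, so the
    signature has to be nonempty; this is where \<open>n > 1\<close> enters.\<close>
  have "prime_factors n \<noteq> {}"
    using assms by (simp add: prime_factorization_empty_iff)
  hence "prime_signature n \<noteq> {#}"
    by (simp add: prime_signature_def mset_set_empty_iff)
  thus ?thesis
    using assms by (simp add: E_value_iff_E_closed E_closed_prime_signature card_parcs_hasse_diagram)
qed

end
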